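(* Let $X=\ell_1$ (complex sequences indexed by $\mathbb Z_+$). A typical $T\in(\mathcal B_1(X),\mathrm{SOT})$ satisfies the following properties: the adjoint $T^*$ is a non-surjective isometry of $X^*$; $T-\lambda$ is surjective for every $\lambda\in\mathbb D$; and every $\lambda\in\mathbb D$ is an eigenvalue of $T$ with infinite multiplicity, i.e. $\dim\ker(T-\lambda)=\infty$. In particular, a typical $T\in(\mathcal B_1(X),\mathrm{SOT})$ has a non-trivial invariant subspace.
   Context: $\mathcal B_1(X)$ is the set of all bounded linear operators $T$ on $X$ with $\|T\|\le 1$. SOT (Strong Operator Topology) is the topology of pointwise norm convergence on $X$; $(\mathcal B_1(X),\mathrm{SOT})$ is a Polish space. "A typical $T\in(\mathcal B_1(X),\mathrm{SOT})$ satisfies (P)" means that the set of $T\in\mathcal B_1(X)$ satisfying (P) is comeager, i.e. contains a dense $G_\delta$ subset of $(\mathcal B_1(X),\mathrm{SOT})$. $\mathbb D$ is the open unit disk in $\mathbb C$. "Isometry" means linear norm-preserving map, not necessarily onto. A non-trivial invariant subspace of $T$ is a closed linear subspace $E\subseteq X$ with $E\ne\{0\}$, $E\neq X$ and $T(E)\subseteq E$. *)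

theory Defs
  imports "HOL-Analysis.Analysis"
begin

class complex_normed_vector = real_normed_vector +
  fixes scaleC :: "complex \<Rightarrow> 'a \<Rightarrow> 'a"  (infixr "*\<^sub>C" 75)
  assumes scaleC_add_right: "a *\<^sub>C (x + y) = a *\<^sub>C x + a *\<^sub>C y"
    and scaleC_add_left: "(a + b) *\<^sub>C x = a *\<^sub>C x + b *\<^sub>C x"
    and scaleC_scaleC: "a *\<^sub>C b *\<^sub>C x = (a * b) *\<^sub>C x"
    and scaleR_scaleC: "r *\<^sub>R x = complex_of_real r *\<^sub>C x"
    and norm_scaleC: "norm (a *\<^sub>C x) = cmod a * norm x"

lemma scaleC_one: "1 *\<^sub>C x = (x::'a::complex_normed_vector)"
  using scaleR_scaleC[of 1 x] by simp

global_interpretation complex_vector: vector_space "scaleC :: complex \<Rightarrow> 'a \<Rightarrow> 'a::complex_normed_vector"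
  defines csubspace = complex_vector.subspace
    and cspan = complex_vector.span
  by unfold_locales (simp_all add: scaleC_add_right scaleC_add_left scaleC_scaleC scaleC_one)

text \<open>The library's dimension function is \<open>0\<close> on infinite-dimensional spaces, so infinite
  dimension is expressed as not being contained in the span of a finite set.\<close>

definition cfinite_dim :: "'a::complex_normed_vector set \<Rightarrow> bool" where
  "cfinite_dim E \<longleftrightarrow> (\<exists>B. finite B \<and> E \<subseteq> cspan B)"

instantiation complex :: complex_normed_vector
begin
definition scaleC_complex :: "complex \<Rightarrow> complex \<Rightarrow> complex" where
  "scaleC_complex a x = a * x"
instance
  by standard (simp_all add: scaleC_complex_def algebra_simps norm_mult scaleR_conv_of_real)
end

lemma bounded_linear_scaleC: "bounded_linear (\<lambda>x::'a::complex_normed_vector. a *\<^sub>C x)"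
proof (rule bounded_linear_intro[where K = "cmod a"])
  fix r :: real and x :: 'a
  show "a *\<^sub>C r *\<^sub>R x = r *\<^sub>R a *\<^sub>C x"
    by (simp add: scaleR_scaleC scaleC_scaleC mult.commute)
qed (simp_all add: scaleC_add_right norm_scaleC mult.commute)

instantiation blinfun :: (real_normed_vector, complex_normed_vector) complex_normed_vector
begin
lift_definition scaleC_blinfun :: "complex \<Rightarrow> 'a \<Rightarrow>\<^sub>L 'b \<Rightarrow> 'a \<Rightarrow>\<^sub>L 'b" is "\<lambda>a f x. a *\<^sub>C f x"
  by (rule bounded_linear_compose[OF bounded_linear_scaleC])
instance
proof
  fix a b :: complex and r :: real and f g :: "'a \<Rightarrow>\<^sub>L 'b"
  show "a *\<^sub>C (f + g) = a *\<^sub>C f + a *\<^sub>C g" by transfer (simp add: scaleC_add_right)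
  show "(a + b) *\<^sub>C f = a *\<^sub>C f + b *\<^sub>C f" by transfer (simp add: scaleC_add_left)
  show "a *\<^sub>C b *\<^sub>C f = (a * b) *\<^sub>C f" by transfer (simp add: scaleC_scaleC)
  show "r *\<^sub>R f = complex_of_real r *\<^sub>C f" by transfer (simp add: scaleR_scaleC)
  have le: "norm (c *\<^sub>C h) \<le> cmod c * norm h" for c and h :: "'a \<Rightarrow>\<^sub>L 'b"
  proof (rule norm_blinfun_bound)
    fix x
    have "norm (blinfun_apply (c *\<^sub>C h) x) = cmod c * norm (blinfun_apply h x)"
      by (simp add: scaleC_blinfun.rep_eq norm_scaleC)
    also have "\<dots> \<le> cmod c * (norm h * norm x)"
      by (intro mult_left_mono norm_blinfun) simp
    finally show "norm (blinfun_apply (c *\<^sub>C h) x) \<le> cmod c * norm h * norm x"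
      by (simp add: mult.assoc)
  qed simp
  show "norm (a *\<^sub>C f) = cmod a * norm f"
  proof (cases "a = 0")
    case True
    then show ?thesis using le[of a f] by simp
  next
    case False
    have "inverse a *\<^sub>C a *\<^sub>C f = f"
      using False by (intro blinfun_eqI) (simp add: scaleC_blinfun.rep_eq scaleC_scaleC scaleC_one)
    then have "norm f \<le> inverse (cmod a) * norm (a *\<^sub>C f)"
      using le[of "inverse a" "a *\<^sub>C f"] by (simp add: norm_inverse)
    then have "cmod a * norm f \<le> norm (a *\<^sub>C f)"
      using False by (simp add: field_simps)
    with le[of a f] show ?thesis by simp
  qed
qed
end

text \<open>The type \<^typ>\<open>'a \<Rightarrow>\<^sub>L 'b\<close> consists of the bounded real-linear maps; the
  bounded complex-linear ones are carved out as a subset.\<close>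

definition clinear_ops :: "('a::complex_normed_vector \<Rightarrow>\<^sub>L 'b::complex_normed_vector) set" where
  "clinear_ops = {T. \<forall>a x. blinfun_apply T (a *\<^sub>C x) = a *\<^sub>C blinfun_apply T x}"

definition contractions :: "('a::complex_normed_vector \<Rightarrow>\<^sub>L 'a) set" where
  "contractions = {T \<in> clinear_ops. norm T \<le> 1}"

definition cdual :: "('a::complex_normed_vector \<Rightarrow>\<^sub>L complex) set" where
  "cdual = clinear_ops"

definition adjoint_op ::
  "('a::complex_normed_vector \<Rightarrow>\<^sub>L 'b::complex_normed_vector) \<Rightarrow> ('b \<Rightarrow>\<^sub>L complex) \<Rightarrow> ('a \<Rightarrow>\<^sub>L complex)" where
  "adjoint_op T f = f o\<^sub>L T"

definition linear_isometry_on ::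
  "'a::complex_normed_vector set \<Rightarrow> 'b::complex_normed_vector set \<Rightarrow> ('a \<Rightarrow> 'b) \<Rightarrow> bool" where
  "linear_isometry_on V W f \<longleftrightarrow> f ` V \<subseteq> W \<and>
     (\<forall>x\<in>V. \<forall>y\<in>V. f (x + y) = f x + f y) \<and>
     (\<forall>a. \<forall>x\<in>V. f (a *\<^sub>C x) = a *\<^sub>C f x) \<and>
     (\<forall>x\<in>V. norm (f x) = norm x)"

definition op_ker :: "('a::complex_normed_vector \<Rightarrow>\<^sub>L 'b::complex_normed_vector) \<Rightarrow> 'a set" where
  "op_ker T = {x. blinfun_apply T x = 0}"

definition eigenvalue :: "('a::complex_normed_vector \<Rightarrow>\<^sub>L 'a) \<Rightarrow> complex \<Rightarrow> bool" where
  "eigenvalue T l \<longleftrightarrow> (\<exists>x. x \<noteq> 0 \<and> blinfun_apply T x = l *\<^sub>C x)"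

definition nontrivial_invariant_subspace :: "('a::complex_normed_vector \<Rightarrow>\<^sub>L 'a) \<Rightarrow> 'a set \<Rightarrow> bool" where
  "nontrivial_invariant_subspace T E \<longleftrightarrow>
     csubspace E \<and> closed E \<and> E \<noteq> {0} \<and> E \<noteq> UNIV \<and> blinfun_apply T ` E \<subseteq> E"

definition comeager_in :: "'a topology \<Rightarrow> 'a set \<Rightarrow> bool" where
  "comeager_in X S \<longleftrightarrow> (\<exists>G. gdelta_in X G \<and> X closure_of G = topspace X \<and> G \<subseteq> S)"

definition typical_contraction :: "('a::complex_normed_vector \<Rightarrow>\<^sub>L 'a \<Rightarrow> bool) \<Rightarrow> bool" where
  "typical_contraction P \<longleftrightarrow>
     comeager_in (subtopology strong_operator_topology contractions) {T \<in> contractions. P T}"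

typedef l1 = "{x :: nat \<Rightarrow> complex. summable (\<lambda>n. cmod (x n))}"
  morphisms l1_nth Abs_l1
  by (rule exI[of _ "\<lambda>_. 0"]) simp

setup_lifting type_definition_l1

lemma summable_l1: "summable (\<lambda>n. cmod (l1_nth x n))"
  using l1_nth[of x] by simp

lemma summable_cmod_add:
  assumes "summable (\<lambda>n. cmod (f n))" "summable (\<lambda>n. cmod (g n))"
  shows "summable (\<lambda>n. cmod (f n + g n))"
  by (rule summable_comparison_test'[OF summable_add[OF assms], of 0])
    (simp add: norm_triangle_ineq)

instantiation l1 :: complex_normed_vector
begin

lift_definition zero_l1 :: l1 is "\<lambda>_. 0" by simp
lift_definition plus_l1 :: "l1 \<Rightarrow> l1 \<Rightarrow> l1" is "\<lambda>x y n. x n + y n"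
  by (rule summable_cmod_add)
lift_definition uminus_l1 :: "l1 \<Rightarrow> l1" is "\<lambda>x n. - x n" by simp
lift_definition minus_l1 :: "l1 \<Rightarrow> l1 \<Rightarrow> l1" is "\<lambda>x y n. x n - y n"
  using summable_cmod_add[where g = "\<lambda>n. - _ n"] by simp
lift_definition scaleC_l1 :: "complex \<Rightarrow> l1 \<Rightarrow> l1" is "\<lambda>a x n. a * x n"
  by (simp add: norm_mult summable_mult)
lift_definition scaleR_l1 :: "real \<Rightarrow> l1 \<Rightarrow> l1" is "\<lambda>r x n. r *\<^sub>R x n"
  by (simp add: summable_mult)
lift_definition norm_l1 :: "l1 \<Rightarrow> real" is "\<lambda>x. \<Sum>n. cmod (x n)" .

definition sgn_l1 :: "l1 \<Rightarrow> l1" where "sgn_l1 x = inverse (norm x) *\<^sub>R x"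
definition dist_l1 :: "l1 \<Rightarrow> l1 \<Rightarrow> real" where "dist_l1 x y = norm (x - y)"
definition uniformity_l1 :: "(l1 \<times> l1) filter" where
  "uniformity_l1 = (INF e\<in>{0<..}. principal {(x, y). dist x y < e})"
definition open_l1 :: "l1 set \<Rightarrow> bool" where
  "open_l1 U = (\<forall>x\<in>U. \<forall>\<^sub>F (x', y) in uniformity. x' = x \<longrightarrow> y \<in> U)"

instance
proof
  fix x y :: l1 and a b :: complex and r s :: real
  show "norm x = 0 \<longleftrightarrow> x = 0"
    by transfer (auto simp: suminf_eq_zero_iff)
  show "norm (x + y) \<le> norm x + norm y"
  proof transfer
    fix x y :: "nat \<Rightarrow> complex"
    assume s: "summable (\<lambda>n. cmod (x n))" "summable (\<lambda>n. cmod (y n))"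
    have "(\<Sum>n. cmod (x n + y n)) \<le> (\<Sum>n. cmod (x n) + cmod (y n))"
      by (intro suminf_le norm_triangle_ineq summable_cmod_add summable_add s)
    also have "\<dots> = (\<Sum>n. cmod (x n)) + (\<Sum>n. cmod (y n))"
      by (rule suminf_add[OF s, symmetric])
    finally show "(\<Sum>n. cmod (x n + y n)) \<le> (\<Sum>n. cmod (x n)) + (\<Sum>n. cmod (y n))" .
  qed
  show "norm (r *\<^sub>R x) = \<bar>r\<bar> * norm x"
    by transfer (simp add: suminf_mult)
  show "norm (a *\<^sub>C x) = cmod a * norm x"
    by transfer (simp add: norm_mult suminf_mult)
  show "r *\<^sub>R x = complex_of_real r *\<^sub>C x"
    by transfer (simp add: scaleR_conv_of_real)
  show "sgn x = inverse (norm x) *\<^sub>R x" by (rule sgn_l1_def)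
  show "dist x y = norm (x - y)" by (rule dist_l1_def)
  show "uniformity = (INF e\<in>{0<..}. principal {(x :: l1, y). dist x y < e})"
    by (rule uniformity_l1_def)
  show "open U = (\<forall>x\<in>U. \<forall>\<^sub>F (x', y) in uniformity. x' = x \<longrightarrow> y \<in> U)" for U :: "l1 set"
    by (rule open_l1_def)
qed (transfer, simp add: algebra_simps)+

end

end

theory Submission
  imports Defs
begin

text \<open>A contraction \<open>T\<close> of \<open>\<ell>\<^sub>1\<close> whose image of the unit ball is dense in the unit ball has, for
  every \<open>C > 1\<close>, a right inverse \<open>R\<close> of norm at most \<open>C\<close>, because operators on \<open>\<ell>\<^sub>1\<close> may be prescribed
  arbitrarily on the unit vectors \<open>e\<^sub>j\<close>. From \<open>f = (f \<circ> T) \<circ> R\<close> the adjoint is isometric, and since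
  \<open>(T - \<lambda>) R = I - \<lambda> R\<close> is invertible when \<open>C \<bar>\<lambda>\<bar> < 1\<close>, the operator \<open>T - \<lambda>\<close> is onto; moreover
  \<open>I - \<lambda> R\<close> maps \<open>ker (T - \<lambda>)\<close> onto \<open>ker T\<close>. If in addition \<open>\<parallel>T e\<^sub>j\<parallel> < 1/2\<close> for infinitely many \<open>j\<close>,
  then \<open>ker T\<close> contains the vectors \<open>e\<^sub>j - R T e\<^sub>j\<close>, which are so close to the \<open>e\<^sub>j\<close> that they stay
  independent. Both requirements on \<open>T\<close> are \<open>G\<^sub>\<delta>\<close>. They are dense without any appeal to Baire's theorem:
  keep the first \<open>N\<close> columns of a given contraction and let the remaining ones run through
  \<open>e\<^sub>0, 0, e\<^sub>1, 0, e\<^sub>2, \<dots>\<close>.\<close>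

section \<open>Operators on complex normed spaces: perturbed identity, dimension, kernels\<close>

lemma clinear_opsD: "T \<in> clinear_ops \<Longrightarrow> blinfun_apply T (a *\<^sub>C x) = a *\<^sub>C blinfun_apply T x"
  by (simp add: clinear_ops_def)

text \<open>The map \<open>x \<mapsto> y + A x\<close> contracts distances by the factor
  \<open>norm A\<close>, so Banach's fixed point theorem supplies the solution.\<close>

lemma surj_id_minus_blinfun:
  fixes A :: "'a::banach \<Rightarrow>\<^sub>L 'a"
  assumes "norm A < 1"
  obtains x where "x - blinfun_apply A x = y"
proof -
  have "\<exists>!x. y + blinfun_apply A x = x"
  proof (rule banach_fix_type[of "norm A"])
    show "\<forall>x z. dist (y + blinfun_apply A x) (y + blinfun_apply A z) \<le> norm A * dist x z"
      by (simp add: dist_norm norm_blinfun flip: blinfun.diff_right)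
  qed (use assms in auto)
  then obtain x where "y + blinfun_apply A x = x"
    by blast
  then show ?thesis
    by (intro that[of x]) (metis add_diff_cancel_right')
qed

text \<open>Serves to carry infinite dimension from \<open>ker T\<close> back to
  \<open>ker (T - \<lambda>)\<close>.\<close>

lemma cfinite_dim_image:
  assumes A: "A \<in> clinear_ops" and E: "cfinite_dim E"
  shows "cfinite_dim (blinfun_apply A ` E)"
proof -
  from E obtain B where B: "finite B" "E \<subseteq> cspan B"
    by (auto simp: cfinite_dim_def)
  have "blinfun_apply A x \<in> cspan (blinfun_apply A ` B)" if "x \<in> cspan B" for x
    using that
  proof (induction rule: complex_vector.span_induct_alt)
    case base
    then show ?case
      by (simp add: complex_vector.span_zero)
  next
    case (step c x y)
    then show ?case
      by (simp add: blinfun.add_right clinear_opsD[OF A] complex_vector.span_add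
          complex_vector.span_scale complex_vector.span_base)
  qed
  with B show ?thesis
    unfolding cfinite_dim_def by (intro exI[of _ "blinfun_apply A ` B"]) auto
qed

lemma eigenvalue_iff_op_ker:
  "eigenvalue T l \<longleftrightarrow> op_ker (T - l *\<^sub>C id_blinfun) \<noteq> {0}"
  by (auto simp: eigenvalue_def op_ker_def blinfun.diff_left scaleC_blinfun.rep_eq)

lemma not_cfinite_dim_imp_nonzero: "\<not> cfinite_dim E \<Longrightarrow> E \<noteq> {0}"
  by (auto simp: cfinite_dim_def complex_vector.span_zero intro!: exI[of _ "{}"])

text \<open>Invariance is immediate because \<open>T\<close> sends its kernel to \<open>0\<close>;
  the kernel is proper because \<open>T \<noteq> 0\<close>.\<close>

lemma nontrivial_invariant_subspace_op_ker:
  fixes T :: "'a::complex_normed_vector \<Rightarrow>\<^sub>L 'a"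
  assumes T: "T \<in> clinear_ops" and "op_ker T \<noteq> {0}" and "T \<noteq> 0"
  shows "nontrivial_invariant_subspace T (op_ker T)"
proof -
  have "csubspace (op_ker T)"
    by (auto simp: complex_vector.subspace_def op_ker_def blinfun.add_right clinear_opsD[OF T])
  moreover have "closed (op_ker T)"
    unfolding op_ker_def by (intro closed_Collect_eq continuous_intros)
  moreover have "op_ker T \<noteq> UNIV"
    using \<open>T \<noteq> 0\<close> by (auto simp: op_ker_def intro!: blinfun_eqI)
  ultimately show ?thesis
    using assms by (auto simp: nontrivial_invariant_subspace_def op_ker_def)
qed

section \<open>The Banach space \<open>\<ell>\<^sub>1\<close>\<close>

lemma cmod_l1_nth_le: "cmod (l1_nth x n) \<le> norm x"
proof transfer
  fix x :: "nat \<Rightarrow> complex" and n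
  assume "summable (\<lambda>n. cmod (x n))"
  then show "cmod (x n) \<le> (\<Sum>n. cmod (x n))"
    using sum_le_suminf[of "\<lambda>n. cmod (x n)" "{n}"] by simp
qed

lemma sum_cmod_l1_nth_le: "(\<Sum>n<k. cmod (l1_nth x n)) \<le> norm x"
  by (simp add: norm_l1.rep_eq sum_le_suminf summable_l1)

text \<open>The limit is taken coordinatewise. Estimates on finitely many coordinates survive this
  limit, and letting their number grow turns them into norm estimates.\<close>

instance l1 :: banach
proof
  fix X :: "nat \<Rightarrow> l1"
  assume X: "Cauchy X"
  have "Cauchy (\<lambda>m. l1_nth (X m) n)" for n
  proof (rule CauchyI)
    fix e :: real assume "0 < e"
    then obtain M where "\<forall>m\<ge>M. \<forall>k\<ge>M. norm (X m - X k) < e"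
      using CauchyD[OF X] by blast
    then show "\<exists>M. \<forall>m\<ge>M. \<forall>k\<ge>M. cmod (l1_nth (X m) n - l1_nth (X k) n) < e"
      by (intro exI[of _ M])
        (auto intro: le_less_trans[OF cmod_l1_nth_le[of "X _ - X _" n, unfolded minus_l1.rep_eq]])
  qed
  then have conv: "convergent (\<lambda>m. l1_nth (X m) n)" for n
    by (rule Cauchy_convergent)
  define y where "y n = lim (\<lambda>m. l1_nth (X m) n)" for n
  have y: "(\<lambda>m. l1_nth (X m) n) \<longlonglongrightarrow> y n" for n
    using conv[of n] by (simp add: y_def convergent_LIMSEQ_iff)
  have bound: "(\<Sum>n<K. cmod (l1_nth (X m) n - y n)) \<le> e"
    if M: "\<And>m k. m \<ge> M \<Longrightarrow> k \<ge> M \<Longrightarrow> norm (X m - X k) < e" and m: "m \<ge> M" for M e m K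
  proof (rule LIMSEQ_le_const2)
    show "(\<lambda>k. \<Sum>n<K. cmod (l1_nth (X m) n - l1_nth (X k) n))
        \<longlonglongrightarrow> (\<Sum>n<K. cmod (l1_nth (X m) n - y n))"
      by (intro tendsto_intros y)
    have "(\<Sum>n<K. cmod (l1_nth (X m) n - l1_nth (X k) n)) \<le> e" if "k \<ge> M" for k
      using sum_cmod_l1_nth_le[where x = "X m - X k" and k = K] M[OF m that]
      by (simp add: minus_l1.rep_eq)
    then show "\<exists>N. \<forall>k\<ge>N. (\<Sum>n<K. cmod (l1_nth (X m) n - l1_nth (X k) n)) \<le> e"
      by blast
  qed
  have summ: "summable (\<lambda>n. cmod (l1_nth (X m) n - y n))"
    if M: "\<And>m k. m \<ge> M \<Longrightarrow> k \<ge> M \<Longrightarrow> norm (X m - X k) < e" and m: "m \<ge> M" for M e m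
    using bound[where M = M and e = e and m = m, OF M m] by (intro summableI_nonneg_bounded) auto
  obtain M1 where M1: "\<And>m k. m \<ge> M1 \<Longrightarrow> k \<ge> M1 \<Longrightarrow> norm (X m - X k) < 1"
    using CauchyD[OF X, of 1] by auto
  \<comment> \<open>Here \<open>y\<close> is written as \<open>X M1 - (X M1 - y)\<close>, a
    difference of two summable sequences.\<close>
  have "summable (\<lambda>n. cmod (l1_nth (X M1) n + - (l1_nth (X M1) n - y n)))"
    using summ[where M = M1 and e = 1 and m = M1, OF M1 order_refl] by (intro summable_cmod_add summable_l1) (simp add: norm_minus_commute)
  then have y_l1: "l1_nth (Abs_l1 y) = y"
    by (intro Abs_l1_inverse) simp
  have "X \<longlonglongrightarrow> Abs_l1 y"
  proof (rule LIMSEQ_I)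
    fix e :: real assume "0 < e"
    then obtain M where M: "\<And>m k. m \<ge> M \<Longrightarrow> k \<ge> M \<Longrightarrow> norm (X m - X k) < e / 2"
      using CauchyD[OF X, of "e / 2"] by auto
    have "norm (X m - Abs_l1 y) < e" if m: "m \<ge> M" for m
    proof -
      have "norm (X m - Abs_l1 y) = (\<Sum>n. cmod (l1_nth (X m) n - y n))"
        by (simp add: norm_l1.rep_eq minus_l1.rep_eq y_l1)
      also have "\<dots> \<le> e / 2"
        by (rule suminf_le_const[OF summ[where M = M and e = "e / 2" and m = m, OF M m]
              bound[where M = M and e = "e / 2" and m = m, OF M m]])
      finally show ?thesis
        using \<open>0 < e\<close> by linarith
    qed
    then show "\<exists>M. \<forall>m\<ge>M. norm (X m - Abs_l1 y) < e"
      by iprover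
  qed
  then show "convergent X"
    by (auto simp: convergent_def)
qed

section \<open>Unit vectors and operators given by their columns\<close>

lift_definition unit_l1 :: "nat \<Rightarrow> l1" is "\<lambda>j n. if n = j then 1 else 0"
  by (rule summable_finite[of "{j}" for j]) auto

lemma l1_nth_sum: "l1_nth (\<Sum>j\<in>F. f j) n = (\<Sum>j\<in>F. l1_nth (f j) n)"
  by (induction F rule: infinite_finite_induct) (simp_all add: zero_l1.rep_eq plus_l1.rep_eq)

lemma l1_nth_sum_unit:
  assumes "finite F"
  shows "l1_nth (\<Sum>j\<in>F. a j *\<^sub>C unit_l1 j) n = (if n \<in> F then a n else 0)"
proof -
  have "l1_nth (\<Sum>j\<in>F. a j *\<^sub>C unit_l1 j) n = (\<Sum>j\<in>F. if n = j then a j else 0)"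
    by (simp add: l1_nth_sum scaleC_l1.rep_eq unit_l1.rep_eq if_distrib cong: if_cong)
  then show ?thesis
    using assms by simp
qed

lemma norm_sum_unit_l1:
  assumes "finite F"
  shows "norm (\<Sum>j\<in>F. a j *\<^sub>C unit_l1 j) = (\<Sum>j\<in>F. cmod (a j))"
proof -
  have "(\<lambda>n. if n \<in> F then cmod (a n) else 0) sums (\<Sum>j\<in>F. cmod (a j))"
    by (rule sums_If_finite_set[OF assms])
  then show ?thesis
    by (simp add: norm_l1.rep_eq l1_nth_sum_unit[OF assms] if_distrib sums_iff cong: if_cong)
qed

lemma norm_unit_l1 [simp]: "norm (unit_l1 j) = 1"
  using norm_sum_unit_l1[of "{j}" "\<lambda>_. 1"] by (simp add: scaleC_one)

text \<open>Cutting off coordinates subtracts exactly in this norm: the tail has norm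
  \<open>norm x\<close> minus a partial sum of the moduli, which tends to \<open>0\<close>.\<close>

lemma sums_unit_l1: "(\<lambda>j. l1_nth x j *\<^sub>C unit_l1 j) sums x"
proof -
  have tail: "norm (x - (\<Sum>j<N. l1_nth x j *\<^sub>C unit_l1 j)) = norm x - (\<Sum>j<N. cmod (l1_nth x j))" for N
  proof -
    have "(\<lambda>n. cmod (l1_nth x n) - (if n \<in> {..<N} then cmod (l1_nth x n) else 0)) sums
        (norm x - (\<Sum>j<N. cmod (l1_nth x j)))"
      unfolding norm_l1.rep_eq
      by (intro sums_diff summable_sums summable_l1 sums_If_finite_set finite_lessThan)
    moreover have "(\<lambda>n. cmod (l1_nth x n) - (if n \<in> {..<N} then cmod (l1_nth x n) else 0)) =
        (\<lambda>n. cmod (l1_nth (x - (\<Sum>j<N. l1_nth x j *\<^sub>C unit_l1 j)) n))"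
      by (auto simp: minus_l1.rep_eq l1_nth_sum_unit)
    ultimately show ?thesis
      by (simp add: norm_l1.rep_eq[of "x - _"] sums_iff)
  qed
  have "(\<lambda>N. norm x - (\<Sum>j<N. cmod (l1_nth x j))) \<longlonglongrightarrow> norm x - norm x"
    unfolding norm_l1.rep_eq by (intro tendsto_diff tendsto_const summable_LIMSEQ summable_l1)
  then have "(\<lambda>N. norm (x - (\<Sum>j<N. l1_nth x j *\<^sub>C unit_l1 j))) \<longlonglongrightarrow> 0"
    by (simp add: tail)
  then have "(\<lambda>N. x - (\<Sum>j<N. l1_nth x j *\<^sub>C unit_l1 j)) \<longlonglongrightarrow> 0"
    by (rule tendsto_norm_zero_cancel)
  from tendsto_diff[OF tendsto_const[of x] this] show ?thesis
    by (simp add: sums_def)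
qed

text \<open>Applying an operator to the expansion \<open>sums_unit_l1\<close> recovers it from its
  columns.\<close>

lemma clinear_ops_l1_eqI:
  fixes S T :: "l1 \<Rightarrow>\<^sub>L 'b::complex_normed_vector"
  assumes "S \<in> clinear_ops" "T \<in> clinear_ops"
    and "\<And>j. blinfun_apply S (unit_l1 j) = blinfun_apply T (unit_l1 j)"
  shows "S = T"
proof (rule blinfun_eqI)
  fix x
  have "(\<lambda>j. l1_nth x j *\<^sub>C blinfun_apply A (unit_l1 j)) sums blinfun_apply A x"
    if "A \<in> clinear_ops" for A :: "l1 \<Rightarrow>\<^sub>L 'b"
    using bounded_linear.sums[OF blinfun.bounded_linear_right sums_unit_l1, of A x]
    by (simp add: clinear_opsD[OF that])
  from this[OF assms(1)] this[OF assms(2)] show "blinfun_apply S x = blinfun_apply T x"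
    by (simp add: assms(3) sums_unique2)
qed

text \<open>The series of the \<open>l1_nth x j *\<^sub>C c j\<close> converges absolutely, since
  the coordinates are summable and the columns bounded. The bound \<open>C\<close> passes to the
  operator without loss.\<close>

lemma l1_op_with_columns:
  fixes c :: "nat \<Rightarrow> 'b::{complex_normed_vector, banach}"
  assumes c: "\<And>j. norm (c j) \<le> C"
  shows "\<exists>R\<in>clinear_ops. norm R \<le> C \<and> (\<forall>j. blinfun_apply R (unit_l1 j) = c j)"
proof -
  define f where "f x = (\<Sum>j. l1_nth x j *\<^sub>C c j)" for x
  have C: "0 \<le> C"
    using c[of 0] norm_ge_zero order_trans by blast
  have le: "norm (l1_nth x j *\<^sub>C c j) \<le> cmod (l1_nth x j) * C" for x j
    by (simp add: norm_scaleC mult_left_mono c)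
  have summ: "summable (\<lambda>j. norm (l1_nth x j *\<^sub>C c j))" for x
    using le by (intro summable_comparison_test'[OF summable_mult2[OF summable_l1, of x C], of 0]) simp
  note summ' = summable_norm_cancel[OF summ]
  have add: "f (x + y) = f x + f y" for x y
    by (simp add: f_def plus_l1.rep_eq scaleC_add_left suminf_add summ')
  have scale: "f (a *\<^sub>C x) = a *\<^sub>C f x" for a x
    using bounded_linear.suminf[OF bounded_linear_scaleC summ', of a x]
    by (simp add: f_def scaleC_l1.rep_eq flip: scaleC_scaleC)
  have norm: "norm (f x) \<le> norm x * C" for x
  proof -
    have "norm (f x) \<le> (\<Sum>j. norm (l1_nth x j *\<^sub>C c j))"
      unfolding f_def by (rule summable_norm[OF summ])
    also have "\<dots> \<le> (\<Sum>j. cmod (l1_nth x j) * C)"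
      by (intro suminf_le le summ summable_mult2 summable_l1)
    also have "\<dots> = norm x * C"
      by (simp add: norm_l1.rep_eq suminf_mult2[symmetric] summable_l1)
    finally show ?thesis .
  qed
  have bl: "bounded_linear f"
    using norm by (intro bounded_linear_intro[where K = C] add) (simp_all add: scaleR_scaleC scale)
  have f_unit: "f (unit_l1 j) = c j" for j
  proof -
    have "f (unit_l1 j) = (\<Sum>i\<in>{j}. l1_nth (unit_l1 j) i *\<^sub>C c i)"
      unfolding f_def by (rule suminf_finite) (auto simp: unit_l1.rep_eq)
    then show ?thesis
      by (simp add: unit_l1.rep_eq scaleC_one)
  qed
  show ?thesis
  proof (intro bexI[of _ "Blinfun f"] conjI allI)
    show "norm (Blinfun f) \<le> C"
      using norm by (intro norm_blinfun_bound C) (simp add: bounded_linear_Blinfun_apply[OF bl] mult.commute)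
  qed (simp_all add: bounded_linear_Blinfun_apply[OF bl] clinear_ops_def scale f_unit)
qed

text \<open>A relation between the \<open>k j\<close> with coefficients \<open>a j\<close> leaves
  \<open>\<Sum> a j (e\<^sub>j - k j)\<close> equal to \<open>\<Sum> a j e\<^sub>j\<close>. Its norm
  is both \<open>\<Sum> |a j|\<close> and at most \<open>c\<close> times that, so all coefficients
  vanish.\<close>

lemma not_cfinite_dim_near_units:
  assumes "infinite J" and "c < 1"
    and k: "\<And>j. j \<in> J \<Longrightarrow> k j \<in> E" "\<And>j. j \<in> J \<Longrightarrow> norm (unit_l1 j - k j) \<le> c"
  shows "\<not> cfinite_dim E"
proof
  have indep: "a i = 0" if F: "finite F" "F \<subseteq> J" and zero: "(\<Sum>j\<in>F. a j *\<^sub>C k j) = 0"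
    and i: "i \<in> F" for F a i
  proof -
    have "(\<Sum>j\<in>F. cmod (a j)) = norm (\<Sum>j\<in>F. a j *\<^sub>C unit_l1 j)"
      by (simp add: norm_sum_unit_l1 F)
    also have "\<dots> = norm (\<Sum>j\<in>F. a j *\<^sub>C (unit_l1 j - k j))"
      using zero by (simp add: complex_vector.scale_right_diff_distrib sum_subtractf)
    also have "\<dots> \<le> (\<Sum>j\<in>F. cmod (a j) * c)"
      using F k(2) by (intro sum_norm_le) (auto simp: norm_scaleC intro!: mult_left_mono)
    finally have "(1 - c) * (\<Sum>j\<in>F. cmod (a j)) \<le> 0"
      by (simp add: left_diff_distrib mult.commute[of _ c] flip: sum_distrib_left)
    then have "(\<Sum>j\<in>F. cmod (a j)) \<le> 0"
      using \<open>c < 1\<close> by (simp add: mult_le_0_iff)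
    then have "(\<Sum>j\<in>F. cmod (a j)) = 0"
      by (intro antisym sum_nonneg) auto
    then show ?thesis
      using i F by (simp add: sum_nonneg_eq_0_iff)
  qed
  have inj: "inj_on k J"
  proof (rule inj_onI, rule ccontr)
    fix i j assume "i \<in> J" "j \<in> J" "k i = k j" "i \<noteq> j"
    then show False
      using indep[of "{i, j}" "\<lambda>n. if n = i then 1 else -1" i] by (simp add: scaleC_one)
  qed
  have "complex_vector.independent (k ` J)"
    unfolding complex_vector.independent_explicit_finite_subsets
  proof (intro allI impI ballI)
    fix S u v
    assume "S \<subseteq> k ` J" "finite S" and zero: "(\<Sum>v\<in>S. u v *\<^sub>C v) = 0" and v: "v \<in> S"
    then obtain F where F: "F \<subseteq> J" "finite F" "S = k ` F"
      using finite_subset_image[of S k J] by blast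
    then have "(\<Sum>j\<in>F. u (k j) *\<^sub>C k j) = 0"
      using zero inj by (simp add: sum.reindex inj_on_subset)
    with indep[of F "u \<circ> k"] F v show "u v = 0"
      by auto
  qed
  moreover assume "cfinite_dim E"
  then obtain B where "finite B" "E \<subseteq> cspan B"
    by (auto simp: cfinite_dim_def)
  moreover have "k ` J \<subseteq> E"
    using k(1) by auto
  ultimately have "finite (k ` J)"
    using complex_vector.independent_span_bound by blast
  then show False
    using inj \<open>infinite J\<close> finite_imageD by blast
qed

section \<open>Generic contractions\<close>

text \<open>Testing only unit vectors and the radii \<open>1 / Suc n\<close> keeps the conditions
  countable. For a linear contraction it still expresses density of the image of the unit ball in
  the unit ball, which is the closed absolutely convex hull of the unit vectors.\<close>

definition near_metric_surjection :: "(l1 \<Rightarrow>\<^sub>L l1) \<Rightarrow> bool" where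
  "near_metric_surjection T \<longleftrightarrow>
    (\<forall>j n. \<exists>x. norm x \<le> 1 \<and> norm (blinfun_apply T x - unit_l1 j) < 1 / Suc n)"

definition small_columns :: "(l1 \<Rightarrow>\<^sub>L l1) \<Rightarrow> nat set" where
  "small_columns T = {j. norm (blinfun_apply T (unit_l1 j)) < 1 / 2}"

text \<open>Approximate preimages of the unit vectors form the columns of \<open>W\<close>, so
  \<open>T W = I - A\<close> with \<open>A\<close> small. Solving \<open>u - A u = e\<^sub>j\<close>
  and applying \<open>W\<close> gives exact preimages, the columns of \<open>R\<close>.\<close>

lemma right_inverse_exists:
  assumes T: "T \<in> contractions" and near: "near_metric_surjection T" and "1 < C"
  obtains R where "R \<in> clinear_ops" "norm R \<le> C" "\<And>y. blinfun_apply T (blinfun_apply R y) = y"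
proof -
  have Tlin: "T \<in> clinear_ops"
    using T by (simp add: contractions_def)
  obtain n where n: "1 / Suc n < 1 - 1 / C"
    using reals_Archimedean[of "1 - 1 / C"] \<open>1 < C\<close> by (auto simp: inverse_eq_divide)
  \<comment> \<open>Chosen so that \<open>1 / (1 - e) = C\<close>, the bound that results for the
    solutions \<open>u j\<close>.\<close>
  define e where "e = 1 - 1 / C"
  have e: "0 < e" "e < 1"
    using \<open>1 < C\<close> by (auto simp: e_def)
  have "\<exists>x. norm x \<le> 1 \<and> norm (blinfun_apply T x - unit_l1 j) < e" for j
    using near n unfolding near_metric_surjection_def e_def by (meson less_trans)
  then obtain w where w: "\<And>j. norm (w j) \<le> 1" "\<And>j. norm (blinfun_apply T (w j) - unit_l1 j) < e"
    by metis
  obtain W where W: "W \<in> clinear_ops" "norm W \<le> 1" "\<And>j. blinfun_apply W (unit_l1 j) = w j"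
    using l1_op_with_columns[of w, OF w(1)] by blast
  have "norm (unit_l1 j - blinfun_apply T (w j)) \<le> e" for j
    using w(2)[of j] by (simp add: norm_minus_commute)
  then have "\<exists>A\<in>clinear_ops. norm A \<le> e
      \<and> (\<forall>j. blinfun_apply A (unit_l1 j) = unit_l1 j - blinfun_apply T (w j))"
    by (rule l1_op_with_columns)
  then obtain A where A: "A \<in> clinear_ops" "norm A \<le> e"
      "\<And>j. blinfun_apply A (unit_l1 j) = unit_l1 j - blinfun_apply T (w j)"
    by blast
  have "A = id_blinfun - (T o\<^sub>L W)"
    using Tlin W A
    by (intro clinear_ops_l1_eqI)
      (auto simp: clinear_ops_def blinfun.diff_left complex_vector.scale_right_diff_distrib)
  then have TW: "blinfun_apply T (blinfun_apply W u) = u - blinfun_apply A u" for u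
    by (simp add: blinfun.diff_left)
  have "\<exists>u. u - blinfun_apply A u = unit_l1 j" for j
    using surj_id_minus_blinfun[of A "unit_l1 j"] A(2) e by (metis le_less_trans)
  then obtain u where u: "\<And>j. u j - blinfun_apply A (u j) = unit_l1 j"
    by metis
  have "norm (blinfun_apply W (u j)) \<le> C" for j
  proof -
    have "norm (u j) \<le> norm (unit_l1 j) + norm (blinfun_apply A (u j))"
      by (metis u add.commute diff_add_cancel norm_triangle_ineq)
    also have "\<dots> \<le> 1 + e * norm (u j)"
      using norm_blinfun[of A "u j"] A(2) mult_right_mono[OF A(2), of "norm (u j)"] by simp
    finally have "norm (u j) \<le> C"
      using \<open>1 < C\<close> by (simp add: e_def field_simps)
    moreover have "norm (blinfun_apply W (u j)) \<le> 1 * norm (u j)"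
      using norm_blinfun[of W "u j"] mult_right_mono[OF W(2), of "norm (u j)"] by simp
    ultimately show ?thesis
      by simp
  qed
  then have "\<exists>R\<in>clinear_ops. norm R \<le> C
      \<and> (\<forall>j. blinfun_apply R (unit_l1 j) = blinfun_apply W (u j))"
    by (rule l1_op_with_columns)
  then obtain R where R: "R \<in> clinear_ops" "norm R \<le> C"
      "\<And>j. blinfun_apply R (unit_l1 j) = blinfun_apply W (u j)"
    by blast
  have "T o\<^sub>L R = id_blinfun"
    using R(1) Tlin by (intro clinear_ops_l1_eqI) (auto simp: clinear_ops_def R(3) TW u)
  then have "blinfun_apply T (blinfun_apply R y) = y" for y
    by (metis blinfun_apply_blinfun_compose id_blinfun.rep_eq)
  with R that show ?thesis
    by blast
qed

section \<open>Adjoint, kernel and shifts of a generic contraction\<close>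

lemma adjoint_op_isometry:
  assumes T: "T \<in> contractions" and near: "near_metric_surjection T"
  shows "linear_isometry_on cdual cdual (adjoint_op T)"
proof -
  have "norm (f o\<^sub>L T) = norm f" for f :: "l1 \<Rightarrow>\<^sub>L complex"
  proof (rule antisym)
    have "norm (f o\<^sub>L T) \<le> norm f * norm T"
      by (rule norm_blinfun_compose)
    also have "\<dots> \<le> norm f * 1"
      using T by (intro mult_left_mono) (auto simp: contractions_def)
    finally show "norm (f o\<^sub>L T) \<le> norm f"
      by simp
    have le: "norm f \<le> norm (f o\<^sub>L T) * C" if C: "1 < C" for C
    proof -
      obtain R where R: "norm R \<le> C" "\<And>y. blinfun_apply T (blinfun_apply R y) = y"
        using right_inverse_exists[OF T near C] by blast
      have "f = (f o\<^sub>L T) o\<^sub>L R"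
        by (rule blinfun_eqI) (simp add: R)
      then have "norm f \<le> norm (f o\<^sub>L T) * norm R"
        by (metis norm_blinfun_compose)
      also have "\<dots> \<le> norm (f o\<^sub>L T) * C"
        by (intro mult_left_mono R) simp
      finally show ?thesis .
    qed
    \<comment> \<open>The right inverse depends on \<open>C\<close>, but the inequality
      \<open>le\<close> no longer mentions it, so \<open>C\<close> may decrease to
      \<open>1\<close>.\<close>
    show "norm f \<le> norm (f o\<^sub>L T)"
    proof (rule tendsto_lowerbound)
      show "((\<lambda>C. norm (f o\<^sub>L T) * C) \<longlongrightarrow> norm (f o\<^sub>L T)) (at_right 1)"
        by (auto intro!: tendsto_eq_intros)
      show "\<forall>\<^sub>F C in at_right 1. norm f \<le> norm (f o\<^sub>L T) * C"
        using le by (auto simp: eventually_at_filter)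
    qed simp
  qed
  then show ?thesis
    using T unfolding linear_isometry_on_def adjoint_op_def cdual_def contractions_def
    by (auto simp: clinear_ops_def blinfun.add_left scaleC_blinfun.rep_eq intro!: blinfun_eqI)
qed

text \<open>Every functional \<open>g \<circ> T\<close> vanishes on the kernel of \<open>T\<close>,
  while some coordinate functional is nonzero at a nonzero kernel vector.\<close>

lemma adjoint_op_not_surj:
  fixes T :: "l1 \<Rightarrow>\<^sub>L l1"
  assumes "op_ker T \<noteq> {0}"
  shows "adjoint_op T ` cdual \<noteq> cdual"
proof
  assume eq: "adjoint_op T ` cdual = cdual"
  from assms obtain k where k: "blinfun_apply T k = 0" "k \<noteq> 0"
    by (auto simp: op_ker_def)
  then obtain n where n: "l1_nth k n \<noteq> 0"
    by (metis l1_nth_inject zero_l1.rep_eq ext)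
  define f where "f x = l1_nth x n" for x
  have bl: "bounded_linear f"
    by (rule bounded_linear_intro[where K = 1])
      (simp_all add: f_def plus_l1.rep_eq scaleR_l1.rep_eq cmod_l1_nth_le)
  have "Blinfun f \<in> cdual"
    by (simp add: cdual_def clinear_ops_def bounded_linear_Blinfun_apply[OF bl] f_def
        scaleC_l1.rep_eq scaleC_complex_def)
  then obtain g where "Blinfun f = g o\<^sub>L T"
    using eq by (auto simp: adjoint_op_def)
  then have "f k = blinfun_apply (g o\<^sub>L T) k"
    by (metis bounded_linear_Blinfun_apply[OF bl])
  with k n show False
    by (simp add: f_def)
qed

lemma not_cfinite_dim_op_ker:
  assumes T: "T \<in> contractions" and near: "near_metric_surjection T"
    and small: "infinite (small_columns T)"
  shows "\<not> cfinite_dim (op_ker T)"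
proof -
  \<comment> \<open>With columns below \<open>1/2\<close>, the norm \<open>3/2\<close> puts the
    kernel vectors within \<open>3/4 < 1\<close> of the unit vectors.\<close>
  obtain R where R: "norm R \<le> 3/2" "\<And>y. blinfun_apply T (blinfun_apply R y) = y"
    using right_inverse_exists[OF T near, of "3/2"] by auto
  show ?thesis
  proof (rule not_cfinite_dim_near_units[OF small])
    fix j assume "j \<in> small_columns T"
    let ?k = "unit_l1 j - blinfun_apply R (blinfun_apply T (unit_l1 j))"
    show "?k \<in> op_ker T"
      by (simp add: op_ker_def blinfun.diff_right R)
    have "norm (unit_l1 j - ?k) \<le> norm R * norm (blinfun_apply T (unit_l1 j))"
      by (simp add: norm_blinfun)
    also have "\<dots> \<le> 3/2 * (1/2)"
      using R(1) \<open>j \<in> small_columns T\<close> by (intro mult_mono) (auto simp: small_columns_def)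
    finally show "norm (unit_l1 j - ?k) \<le> 3/4"
      by simp
  qed simp
qed

lemma shifted_op:
  assumes T: "T \<in> contractions" and near: "near_metric_surjection T"
    and l: "cmod l < 1"
  shows "surj (blinfun_apply (T - l *\<^sub>C id_blinfun))"
    and "cfinite_dim (op_ker (T - l *\<^sub>C id_blinfun)) \<Longrightarrow> cfinite_dim (op_ker T)"
proof -
  have Tlin: "T \<in> clinear_ops"
    using T by (simp add: contractions_def)
  \<comment> \<open>Both \<open>1 < C\<close> and \<open>cmod l * C < 1\<close> reduce to
    \<open>cmod l < 1\<close> for this value.\<close>
  define C where "C = 2 / (1 + cmod l)"
  have pos: "0 < 1 + cmod l"
    by (simp add: add_pos_nonneg)
  have C: "1 < C" "cmod l * C < 1"
    using l pos by (auto simp: C_def field_simps)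
  obtain R where R: "R \<in> clinear_ops" "norm R \<le> C" "\<And>y. blinfun_apply T (blinfun_apply R y) = y"
    using right_inverse_exists[OF T near C(1)] by blast
  have "norm (l *\<^sub>C R) < 1"
    using mult_left_mono[OF R(2), of "cmod l"] C(2) by (simp add: norm_scaleC)
  then have inv: "\<exists>x. x - l *\<^sub>C blinfun_apply R x = y" for y
    using surj_id_minus_blinfun[of "l *\<^sub>C R" y] by (metis scaleC_blinfun.rep_eq)
  have apply_shift: "blinfun_apply (T - l *\<^sub>C id_blinfun) x = blinfun_apply T x - l *\<^sub>C x" for x
    by (simp add: blinfun.diff_left scaleC_blinfun.rep_eq)
  show "surj (blinfun_apply (T - l *\<^sub>C id_blinfun))"
    \<comment> \<open>If \<open>x - l R x = y\<close>, then \<open>R x\<close> is a preimage of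
      \<open>y\<close>, because \<open>T R x = x\<close>.\<close>
    unfolding surj_def apply_shift by (metis inv R(3))
  define A where "A = id_blinfun - l *\<^sub>C R"
  have A: "blinfun_apply A x = x - l *\<^sub>C blinfun_apply R x" for x
    by (simp add: A_def blinfun.diff_left scaleC_blinfun.rep_eq)
  have "A \<in> clinear_ops"
    using R(1)
    by (simp add: clinear_ops_def A complex_vector.scale_right_diff_distrib scaleC_scaleC mult.commute)
  moreover have "op_ker T \<subseteq> blinfun_apply A ` op_ker (T - l *\<^sub>C id_blinfun)"
  proof
    fix k assume k: "k \<in> op_ker T"
    obtain x where x: "x - l *\<^sub>C blinfun_apply R x = k"
      using inv by blast
    \<comment> \<open>Applying \<open>T\<close> to \<open>k = x - l R x\<close> cancels
      \<open>R\<close>, so \<open>x\<close> lies in \<open>ker (T - l)\<close> exactly when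
      \<open>T k = 0\<close>.\<close>
    then have "blinfun_apply T x - l *\<^sub>C x = blinfun_apply T k"
      by (simp add: blinfun.diff_right clinear_opsD[OF Tlin] R(3) flip: x)
    with k x show "k \<in> blinfun_apply A ` op_ker (T - l *\<^sub>C id_blinfun)"
      by (intro image_eqI[of _ _ x]) (simp_all add: A op_ker_def apply_shift)
  qed
  ultimately show "cfinite_dim (op_ker T)" if "cfinite_dim (op_ker (T - l *\<^sub>C id_blinfun))"
    using cfinite_dim_image[OF _ that] unfolding cfinite_dim_def by (meson order_trans)
qed

section \<open>Comeagerness\<close>

text \<open>The topology is pulled back from the product topology on functions, where convergence is
  pointwise.\<close>

lemma limitin_strong_operator_topology:
  assumes "\<And>x. ((\<lambda>i. blinfun_apply (S i) x) \<longlongrightarrow> blinfun_apply T x) F"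
  shows "limitin strong_operator_topology S T F"
  unfolding limitin_def
proof (intro conjI allI impI)
  show "T \<in> topspace strong_operator_topology"
    by (simp add: strong_operator_topology_topspace)
  have lim: "limitin euclidean (\<lambda>i. blinfun_apply (S i)) (blinfun_apply T) F"
    using assms unfolding euclidean_product_topology[symmetric] limitin_componentwise by simp
  fix U assume "openin strong_operator_topology U \<and> T \<in> U"
  then obtain V where "open V" "U = blinfun_apply -` V" "T \<in> U"
    by (auto simp: strong_operator_topology_def openin_pullback_topology)
  then show "\<forall>\<^sub>F i in F. S i \<in> U"
    using lim by (auto simp: tendsto_def)
qed

lemma openin_strong_operator_topology_ball:
  "openin strong_operator_topology {T. norm (blinfun_apply T x - y) < r}"
  using strong_operator_topology_basis[of "{()}" "\<lambda>_. ball y r" "\<lambda>_. x"]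
  by (simp add: dist_norm norm_minus_commute)

abbreviation generic :: "(l1 \<Rightarrow>\<^sub>L l1) set" where
  "generic \<equiv> {T \<in> contractions. near_metric_surjection T \<and> infinite (small_columns T)}"

text \<open>Each requirement is a countable intersection of unions of the open sets from
  \<open>openin_strong_operator_topology_ball\<close>; infinitude of a set of indices means having a
  member beyond every \<open>m\<close>.\<close>

lemma gdelta_in_generic: "gdelta_in (subtopology strong_operator_topology contractions) generic"
proof -
  let ?X = "subtopology strong_operator_topology (contractions :: (l1 \<Rightarrow>\<^sub>L l1) set)"
  define U where "U j n = (\<Union>x\<in>cball 0 1. {T :: l1 \<Rightarrow>\<^sub>L l1. norm (blinfun_apply T x - unit_l1 j) < 1 / Suc n})" for j n
  define V where "V m = (\<Union>j\<in>{m..}. {T :: l1 \<Rightarrow>\<^sub>L l1. norm (blinfun_apply T (unit_l1 j) - 0) < 1 / 2})" for m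
  have "openin strong_operator_topology (U j n)" "openin strong_operator_topology (V m)" for j n m
    unfolding U_def V_def by (intro openin_Union; use openin_strong_operator_topology_ball in blast)+
  then have gd: "gdelta_in ?X (contractions \<inter> U j n)" "gdelta_in ?X (contractions \<inter> V m)" for j n m
    by (intro open_imp_gdelta_in openin_subtopology_Int2; simp)+
  have near: "near_metric_surjection T \<longleftrightarrow> (\<forall>j n. T \<in> U j n)" for T
    by (simp add: near_metric_surjection_def U_def Bex_def)
  have small: "infinite (small_columns T) \<longleftrightarrow> (\<forall>m. T \<in> V m)" for T
    by (simp add: small_columns_def V_def infinite_nat_iff_unbounded_le Bex_def)
  have "generic = \<Inter> (range (\<lambda>(j, n). contractions \<inter> U j n) \<union> range (\<lambda>m. contractions \<inter> V m))"
    by (auto simp: near small)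
  also have "gdelta_in ?X \<dots>"
    by (rule gdelta_in_Inter) (use gd in auto)
  finally show ?thesis .
qed

lemma generic_dense:
  assumes T: "T \<in> contractions"
  obtains S where "\<And>N. S N \<in> generic" "\<And>x. (\<lambda>N. blinfun_apply (S N) x) \<longlonglongrightarrow> blinfun_apply T x"
proof -
  have Tlin: "T \<in> clinear_ops" and T1: "norm T \<le> 1"
    using T by (auto simp: contractions_def)
  \<comment> \<open>From \<open>N\<close> on, column \<open>N + 2 * i\<close> is
    \<open>e\<^sub>i\<close>, an exact value for surjectivity, and column
    \<open>N + 2 * i + 1\<close> is \<open>0\<close>, a small column.\<close>
  define c where "c N j = (if j < N then blinfun_apply T (unit_l1 j)
      else if even (j - N) then unit_l1 ((j - N) div 2) else 0)" for N j
  have "norm (c N j) \<le> 1" for N j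
    using norm_blinfun[of T "unit_l1 j"] T1 by (auto simp: c_def)
  then have "\<exists>R\<in>clinear_ops. norm R \<le> 1 \<and> (\<forall>j. blinfun_apply R (unit_l1 j) = c N j)" for N
    by (rule l1_op_with_columns)
  then obtain S where S: "\<And>N. S N \<in> clinear_ops" "\<And>N. norm (S N) \<le> 1"
      "\<And>N j. blinfun_apply (S N) (unit_l1 j) = c N j"
    by metis
  show ?thesis
  proof (rule that[of S])
    fix N
    have "near_metric_surjection (S N)"
      unfolding near_metric_surjection_def
    proof (intro allI)
      fix j n
      show "\<exists>x. norm x \<le> 1 \<and> norm (blinfun_apply (S N) x - unit_l1 j) < 1 / real (Suc n)"
        by (intro exI[of _ "unit_l1 (N + 2 * j)"]) (simp add: S c_def)
    qed
    moreover have "infinite (small_columns (S N))"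
      unfolding infinite_nat_iff_unbounded_le
    proof
      fix m
      show "\<exists>n\<ge>m. n \<in> small_columns (S N)"
        by (intro exI[of _ "N + (2 * m + 1)"]) (simp add: small_columns_def S c_def)
    qed
    ultimately show "S N \<in> generic"
      using S by (simp add: contractions_def)
  next
    fix x
    let ?p = "\<lambda>N. \<Sum>j<N. l1_nth x j *\<^sub>C unit_l1 j"
    \<comment> \<open>\<open>S N\<close> and \<open>T\<close> agree on the first \<open>N\<close>
      unit vectors, so only the tail of \<open>x\<close> counts; the factor \<open>2\<close> comes
      from the two contractions.\<close>
    have le: "norm (blinfun_apply (S N) x - blinfun_apply T x) \<le> 2 * norm (x - ?p N)" for N
    proof -
      have "blinfun_apply (S N) (?p N) = blinfun_apply T (?p N)"
        by (simp add: blinfun.sum_right clinear_opsD[OF S(1)] clinear_opsD[OF Tlin] S(3) c_def)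
      then have "blinfun_apply (S N) x - blinfun_apply T x
          = blinfun_apply (S N) (x - ?p N) - blinfun_apply T (x - ?p N)"
        by (simp add: blinfun.diff_right)
      also have "norm \<dots> \<le> norm (blinfun_apply (S N) (x - ?p N)) + norm (blinfun_apply T (x - ?p N))"
        by (rule norm_triangle_ineq4)
      also have "\<dots> \<le> 1 * norm (x - ?p N) + 1 * norm (x - ?p N)"
        by (intro add_mono order_trans[OF norm_blinfun] mult_right_mono S(2) T1) auto
      finally show ?thesis
        by simp
    qed
    have "(\<lambda>N. 2 * norm (x - ?p N)) \<longlonglongrightarrow> 2 * norm (x - x)"
      using sums_unit_l1[of x] unfolding sums_def by (intro tendsto_intros)
    then have "(\<lambda>N. 2 * norm (x - ?p N)) \<longlonglongrightarrow> 0"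
      by simp
    then have "(\<lambda>N. blinfun_apply (S N) x - blinfun_apply T x) \<longlonglongrightarrow> 0"
      by (rule Lim_null_comparison[OF always_eventually[OF allI[OF le]]])
    then show "(\<lambda>N. blinfun_apply (S N) x) \<longlonglongrightarrow> blinfun_apply T x"
      by (rule LIM_zero_cancel)
  qed
qed

text \<open>The approximating sequence from \<open>generic_dense\<close> stays in the closure of
  \<open>generic\<close>, a closed set, and hence so does its limit.\<close>

lemma closure_of_generic:
  "subtopology strong_operator_topology contractions closure_of generic
    = topspace (subtopology strong_operator_topology contractions)" (is "?X closure_of _ = _")
proof (rule subset_antisym[OF closure_of_subset_topspace subsetI])
  fix T assume "T \<in> topspace ?X"
  then have T: "T \<in> contractions"
    by simp
  then obtain S where S: "\<And>N. S N \<in> generic"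
      "\<And>x. (\<lambda>N. blinfun_apply (S N) x) \<longlonglongrightarrow> blinfun_apply T x"
    using generic_dense by blast
  show "T \<in> ?X closure_of generic"
  proof (rule limitin_closedin[where f = S and F = sequentially])
    show "limitin ?X S T sequentially"
      using S T limitin_strong_operator_topology[of S T sequentially]
      by (simp add: limitin_subtopology)
    have "generic \<subseteq> ?X closure_of generic"
      by (intro closure_of_subset) (auto simp: strong_operator_topology_topspace)
    then show "\<forall>\<^sub>F N in sequentially. S N \<in> ?X closure_of generic"
      using S(1) by (intro always_eventually) blast
  qed auto
qed

lemma typical_contractionI:
  assumes "\<And>T :: l1 \<Rightarrow>\<^sub>L l1. T \<in> generic \<Longrightarrow> P T"
  shows "typical_contraction P"
  unfolding typical_contraction_def comeager_in_def
proof (rule exI[of _ generic], intro conjI gdelta_in_generic closure_of_generic)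
  show "generic \<subseteq> {T \<in> contractions. P T}"
    using assms by blast
qed

theorem theorem2p2:
  shows "typical_contraction (\<lambda>T :: l1 \<Rightarrow>\<^sub>L l1.
            (linear_isometry_on cdual cdual (adjoint_op T) \<and> adjoint_op T ` cdual \<noteq> cdual) \<and>
            (\<forall>l \<in> ball (0::complex) 1. surj (blinfun_apply (T - l *\<^sub>C id_blinfun))) \<and>
            (\<forall>l \<in> ball (0::complex) 1. eigenvalue T l \<and> \<not> cfinite_dim (op_ker (T - l *\<^sub>C id_blinfun))))
       \<and> typical_contraction (\<lambda>T :: l1 \<Rightarrow>\<^sub>L l1. \<exists>E. nontrivial_invariant_subspace T E)"
proof (intro conjI; rule typical_contractionI)
  \<comment> \<open>The same dense set witnesses both typicality claims, so one generic
    \<open>T\<close> is treated for both.\<close>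
  fix T :: "l1 \<Rightarrow>\<^sub>L l1"
  assume "T \<in> generic"
  then have T: "T \<in> contractions" and near: "near_metric_surjection T"
    and inf: "infinite (small_columns T)"
    by auto
  have "\<not> cfinite_dim (op_ker T)"
    by (rule not_cfinite_dim_op_ker[OF T near inf])
  then have ker: "op_ker T \<noteq> {0}"
    by (rule not_cfinite_dim_imp_nonzero)
  have inf_dim: "\<not> cfinite_dim (op_ker (T - l *\<^sub>C id_blinfun))" if "cmod l < 1" for l
    using shifted_op(2)[OF T near that] \<open>\<not> cfinite_dim (op_ker T)\<close> by blast
  show "(linear_isometry_on cdual cdual (adjoint_op T) \<and> adjoint_op T ` cdual \<noteq> cdual) \<and>
      (\<forall>l \<in> ball (0::complex) 1. surj (blinfun_apply (T - l *\<^sub>C id_blinfun))) \<and>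
      (\<forall>l \<in> ball (0::complex) 1. eigenvalue T l \<and> \<not> cfinite_dim (op_ker (T - l *\<^sub>C id_blinfun)))"
    using adjoint_op_isometry[OF T near] adjoint_op_not_surj[OF ker] shifted_op(1)[OF T near]
      inf_dim not_cfinite_dim_imp_nonzero[OF inf_dim]
    by (simp add: eigenvalue_iff_op_ker)
  \<comment> \<open>The zero operator has no right inverse, since
    \<open>e\<^sub>0 = T R e\<^sub>0\<close> would vanish.\<close>
  have "T \<noteq> 0"
  proof
    assume "T = 0"
    then show False
      using right_inverse_exists[OF T near, of 2] norm_unit_l1[of 0]
      by (metis blinfun.zero_left norm_zero one_less_numeral_iff semiring_norm(76) zero_neq_one)
  qed
  then show "\<exists>E. nontrivial_invariant_subspace T E"
    using T nontrivial_invariant_subspace_op_ker[OF _ ker] by (auto simp: contractions_def)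
qed

end
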